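(* Let $q$ be an even power of $2$ (i.e., $q=2^v$ with $v$ a positive even integer) and let $s=1+(q+1)(\sqrt{q}-1)$. Then in the desarguesian projective plane $\mathrm{PG}(2,q)$ there exist a set $Y$ of $s$ points and a set $\mathcal{M}$ of $s$ lines such that no point of $Y$ lies on any line of $\mathcal{M}$.
   Context: $\mathrm{PG}(2,q)$ denotes the desarguesian projective plane over the finite field $\mathbb{F}_q$: its points are the 1-dimensional subspaces and its lines the 2-dimensional subspaces of $\mathbb{F}_q^3$, with incidence given by containment. *)

theory Defs
  imports "HOL-Analysis.Cartesian_Space"
begin

definition pg2_points :: "('a::field ^ 3) set set" where
  "pg2_points = {P. vec.subspace P \<and> vec.dim P = 1}"

definition pg2_lines :: "('a::field ^ 3) set set" where
  "pg2_lines = {L. vec.subspace L \<and> vec.dim L = 2}"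

definition pg2_incident :: "('a::field ^ 3) set \<Rightarrow> ('a ^ 3) set \<Rightarrow> bool" where
  "pg2_incident P L \<longleftrightarrow> P \<subseteq> L"

end

theory Submission
  imports Defs "HOL-Computational_Algebra.Polynomial"
begin

text \<open>
  Let \<open>r = \<surd>q\<close>, let \<open>K\<close> be the subfield of order \<open>r\<close>, and let \<open>Q(x, y) = x\<^sup>2 + x y + d y\<^sup>2\<close> with \<open>d\<close> not
  of the form \<open>t\<^sup>2 + t\<close>. The points \<open>(x, y, 1)\<close> with \<open>Q(x, y) \<in> K\<close> form Denniston's maximal arc of
  degree \<open>r\<close>. Its external lines turn out to be the lines \<open>a x + b y + z = 0\<close> with \<open>Q(b, a) \<in> K\<close>, so
  points and lines are counted by the same set: \<open>0\<close> is taken by \<open>Q\<close> once, every other value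
  \<open>q + 1\<close> times. If such a point were on such a line, the norm form \<open>Q\<close> would satisfy
  \<open>Q(b, a) Q(x, y) = X\<^sup>2 + X + d\<close> for some \<open>X\<close>. But the left side lies in \<open>K\<close>, and every element of
  \<open>K\<close> has the form \<open>t\<^sup>2 + t\<close>, which would force \<open>d\<close> to have that form too.
\<close>

definition artin_schreier :: "'a::field set" where
  "artin_schreier = range (\<lambda>t. t\<^sup>2 + t)"

text \<open>For \<open>q = 2 ^ (2 * m)\<close> this fixed set of an iterated Frobenius map is the
  subfield \<open>K\<close>.\<close>

definition frobenius_fixed :: "nat \<Rightarrow> 'a::field set" where
  "frobenius_fixed m = {x. x ^ (2 ^ m) = x}"

definition denniston_form :: "'a::field \<Rightarrow> 'a \<times> 'a \<Rightarrow> 'a" where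
  "denniston_form d p = (fst p)\<^sup>2 + fst p * snd p + d * (snd p)\<^sup>2"

section \<open>Counting and finite-field preliminaries\<close>

lemma card_eq_sum_card_fibres:
  assumes "finite A" "finite B" "f ` A \<subseteq> B"
  shows "card A = (\<Sum>b\<in>B. card {x \<in> A. f x = b})"
proof -
  have "card (\<Union>b\<in>B. {x \<in> A. f x = b}) = (\<Sum>b\<in>B. card {x \<in> A. f x = b})"
    using assms by (intro card_UN_disjoint) auto
  moreover have "(\<Union>b\<in>B. {x \<in> A. f x = b}) = A"
    using assms(3) by auto
  ultimately show ?thesis by simp
qed

lemma finite_field_power_CARD:
  fixes x :: "'a::{field, finite}"
  shows "x ^ CARD('a) = x"
proof (cases "x = 0")
  case True
  then show ?thesis by (simp add: zero_power)
next
  case False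
  let ?U = "UNIV - {0 :: 'a}"
  have card_U: "CARD('a) = Suc (card ?U)"
    by (simp add: card_Suc_Diff1)
  have "bij_betw ((*) x) ?U ?U"
    using False by (intro bij_betwI[of _ _ _ "\<lambda>y. y / x"]) auto
  then have "(\<Prod>y\<in>?U. y) = (\<Prod>y\<in>?U. x * y)"
    by (rule prod.reindex_bij_betw[symmetric])
  also have "\<dots> = x ^ card ?U * (\<Prod>y\<in>?U. y)"
    by (simp add: prod.distrib)
  finally have "x ^ card ?U = 1" by simp
  then show ?thesis by (simp only: card_U power_Suc) simp
qed

text \<open>Translation by 1 permutes the field, so comparing the sums of all elements gives
  \<open>2 ^ v = 0\<close>.\<close>

lemma finite_field_char_two:
  assumes "CARD('a::{field, finite}) = 2 ^ v"
  shows "(2 :: 'a) = 0"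
proof -
  have "bij (\<lambda>x :: 'a. x + 1)"
    by (intro bij_betwI[of _ _ _ "\<lambda>x. x - 1"]) auto
  then have "(\<Sum>x :: 'a\<in>UNIV. x) = (\<Sum>x :: 'a\<in>UNIV. x + 1)"
    by (rule sum.reindex_bij_betw[symmetric])
  then have "(of_nat CARD('a) :: 'a) = 0"
    by (simp add: sum.distrib)
  then show ?thesis using assms by simp
qed

lemma denniston_form_scale:
  "denniston_form d (c * x, c * y) = c\<^sup>2 * denniston_form d (x, y)"
  by (simp add: denniston_form_def algebra_simps power2_eq_square)

text \<open>For \<open>n = r\<close> this bounds the fibres of the trace map
  \<open>t ^ r + t\<close> onto the subfield \<open>K\<close>.\<close>

lemma card_roots_power_add_self_le:
  fixes k :: "'a::field"
  assumes "n \<ge> 2"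
  shows "card {t. t ^ n + t = k} \<le> n"
proof -
  let ?p = "monom 1 n + [:- k, 1:]"
  have deg: "degree ?p = n"
    using assms by (subst degree_add_eq_left) (auto simp: degree_monom_eq)
  then have "?p \<noteq> 0" using assms by auto
  then have "card {t. poly ?p t = 0} \<le> n"
    using card_poly_roots_bound[of ?p] deg by simp
  moreover have "{t. poly ?p t = 0} = {t. t ^ n + t = k}"
    by (auto simp: poly_monom algebra_simps)
  ultimately show ?thesis by simp
qed

section \<open>Characteristic two, the image of \<open>t\<^sup>2 + t\<close>, and the subfield
  \<open>K\<close>\<close>

context
  assumes two_eq_zero: "(2 :: 'a::{field, finite}) = 0"
begin

lemma char_two_add_self: "x + x = (0 :: 'a)"
  using two_eq_zero by (metis mult_2 mult_zero_left)

lemma char_two_add_eq_0_iff: "x + y = 0 \<longleftrightarrow> x = (y :: 'a)"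
  by (metis add_left_cancel char_two_add_self)

lemma char_two_power2_sum: "(x + y)\<^sup>2 = x\<^sup>2 + (y :: 'a)\<^sup>2"
  using two_eq_zero by (simp add: power2_sum)

lemma char_two_power_sum: "(x + y) ^ (2 ^ n) = x ^ (2 ^ n) + (y :: 'a) ^ (2 ^ n)"
proof (induction n)
  case (Suc n)
  have "(x + y) ^ (2 ^ Suc n) = ((x + y) ^ (2 ^ n))\<^sup>2"
    by (simp add: power_mult[symmetric] mult.commute)
  also have "\<dots> = (x ^ (2 ^ n))\<^sup>2 + (y ^ (2 ^ n))\<^sup>2"
    by (simp only: Suc.IH char_two_power2_sum)
  finally show ?case
    by (simp add: power_mult[symmetric] mult.commute)
qed simp

lemma char_two_bij_power2: "bij (\<lambda>x :: 'a. x\<^sup>2)"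
proof -
  have "inj (\<lambda>x :: 'a. x\<^sup>2)"
    by (rule injI) (metis char_two_add_eq_0_iff char_two_power2_sum power_eq_0_iff)
  then show ?thesis by (simp add: bij_def finite_UNIV_inj_surj)
qed

lemma artin_schreier_add:
  fixes x y :: 'a
  assumes "x \<in> artin_schreier" "y \<in> artin_schreier"
  shows "x + y \<in> artin_schreier"
proof -
  obtain t u where "x = t\<^sup>2 + t" "y = u\<^sup>2 + u"
    using assms by (auto simp: artin_schreier_def)
  then have "x + y = (t + u)\<^sup>2 + (t + u)"
    by (simp add: char_two_power2_sum)
  then show ?thesis by (auto simp: artin_schreier_def)
qed

text \<open>0 and 1 have the same image, and a non-injective self-map of a finite set is not onto.
  This supplies \<open>d\<close>.\<close>

lemma artin_schreier_proper: "artin_schreier \<noteq> (UNIV :: 'a set)"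
proof
  assume "artin_schreier = (UNIV :: 'a set)"
  then have "inj (\<lambda>t :: 'a. t\<^sup>2 + t)"
    unfolding artin_schreier_def by (intro finite_UNIV_surj_inj) auto
  moreover have "(1 :: 'a)\<^sup>2 + 1 = 0\<^sup>2 + 0"
    by (simp add: two_eq_zero)
  ultimately have "(1 :: 'a) = 0" by (rule injD)
  then show False by simp
qed

text \<open>The element telescopes as \<open>u\<^sup>2 + u\<close> for \<open>u = t + t\<^sup>2 + t\<^sup>4 + \<dots> + t ^ 2 ^ (n - 1)\<close>.\<close>
lemma power_add_self_in_artin_schreier: "t ^ (2 ^ n) + (t :: 'a) \<in> artin_schreier"
proof (induction n)
  case 0
  have "(0 :: 'a) = 0\<^sup>2 + 0" by simp
  then have "(0 :: 'a) \<in> artin_schreier" unfolding artin_schreier_def by (rule range_eqI)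
  then show ?case by (simp add: two_eq_zero)
next
  case (Suc n)
  let ?y = "t ^ (2 ^ n)"
  have "?y\<^sup>2 + ?y \<in> artin_schreier" by (simp add: artin_schreier_def)
  then have "(?y\<^sup>2 + ?y) + (?y + t) \<in> artin_schreier"
    using Suc.IH by (rule artin_schreier_add)
  moreover have "(?y\<^sup>2 + ?y) + (?y + t) = ?y\<^sup>2 + (?y + ?y) + t"
    by (simp only: ac_simps)
  ultimately have "?y\<^sup>2 + t \<in> artin_schreier"
    by (simp only: char_two_add_self add_0_right)
  then show ?case by (simp add: power_mult[symmetric] mult.commute)
qed

text \<open>The relative trace \<open>\<phi>\<close> sends \<open>r * r\<close> elements into its
  own kernel \<open>K\<close>, with fibres of size at most \<open>r\<close>. As
  \<open>card K\<close> is also at most \<open>r\<close>, counting forces equality and makes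
  \<open>\<phi>\<close> onto \<open>K\<close>; its values lie in
  \<open>artin_schreier\<close>.\<close>

lemma subfield_of_square_order:
  assumes card: "CARD('a) = 2 ^ m * 2 ^ m" and m: "m > 0"
  shows "card (frobenius_fixed m :: 'a set) = 2 ^ m"
    and "frobenius_fixed m \<subseteq> (artin_schreier :: 'a set)"
proof -
  define r :: nat where "r = 2 ^ m"
  define K :: "'a set" where "K = frobenius_fixed m"
  define \<phi> where "\<phi> = (\<lambda>t :: 'a. t ^ r + t)"
  have r: "r \<ge> 2" using m by (cases m) (auto simp: r_def)
  have fibre: "card {t. \<phi> t = k} \<le> r" for k
    unfolding \<phi>_def by (rule card_roots_power_add_self_le[OF r])
  have "K = {t. \<phi> t = 0}"
    by (simp add: K_def frobenius_fixed_def \<phi>_def r_def char_two_add_eq_0_iff)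
  then have card_K_le: "card K \<le> r" using fibre by simp
  have \<phi>_in: "\<phi> t \<in> K" for t
  proof -
    have "\<phi> t ^ r = (t ^ r) ^ r + t ^ r"
      unfolding \<phi>_def r_def by (rule char_two_power_sum)
    also have "(t ^ r) ^ r = t"
      using finite_field_power_CARD[of t] by (simp add: card r_def power_mult)
    finally show ?thesis
      by (simp add: K_def frobenius_fixed_def \<phi>_def r_def add.commute)
  qed
  have sum_fibres: "r * r = (\<Sum>k\<in>K. card {t. \<phi> t = k})"
    using card_eq_sum_card_fibres[of UNIV K \<phi>] \<phi>_in card by (auto simp: r_def)
  also have "\<dots> \<le> card K * r"
    using sum_bounded_above[of K "\<lambda>k. card {t. \<phi> t = k}" r] fibre by simp
  finally have card_K: "card K = r" using card_K_le r by simp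
  then show "card (frobenius_fixed m :: 'a set) = 2 ^ m" by (simp add: K_def r_def)
  \<comment> \<open>A missed value would leave only \<open>r - 1\<close> fibres of size at most
    \<open>r\<close> to cover \<open>r * r\<close> elements.\<close>
  have "k \<in> range \<phi>" if k: "k \<in> K" for k
  proof (rule ccontr)
    assume "k \<notin> range \<phi>"
    then have "{t. \<phi> t = k} = {}" by auto
    then have "r * r = (\<Sum>k\<in>K - {k}. card {t. \<phi> t = k})"
      using sum_fibres k by (simp add: sum.remove)
    also have "\<dots> \<le> card (K - {k}) * r"
      using sum_bounded_above[of "K - {k}" "\<lambda>k. card {t. \<phi> t = k}" r] fibre by simp
    also have "\<dots> < r * r" using k card_K r by simp
    finally show False by simp
  qed
  then show "frobenius_fixed m \<subseteq> (artin_schreier :: 'a set)"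
    using power_add_self_in_artin_schreier by (auto simp: K_def \<phi>_def r_def)
qed

section \<open>The norm form and how often it takes each value\<close>

lemma denniston_form_eq_0_iff:
  fixes d :: 'a
  assumes "d \<notin> artin_schreier"
  shows "denniston_form d p = 0 \<longleftrightarrow> p = (0, 0)"
proof
  assume eq: "denniston_form d p = 0"
  obtain x y where p: "p = (x, y)" by (cases p)
  show "p = (0, 0)"
  proof (cases "y = 0")
    case True
    then show ?thesis using eq p by (simp add: denniston_form_def)
  next
    case False
    have "(x\<^sup>2 + x * y) + d * y\<^sup>2 = 0"
      using eq p by (simp add: denniston_form_def)
    then have "d * y\<^sup>2 = x\<^sup>2 + x * y"
      by (simp only: char_two_add_eq_0_iff)
    then have "d = (x / y)\<^sup>2 + x / y"
      using False by (simp add: field_simps power2_eq_square)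
    then show ?thesis using assms by (auto simp: artin_schreier_def)
  qed
qed (simp add: denniston_form_def)

text \<open>Scaling a vector by \<open>c\<close> multiplies the form by \<open>c\<^sup>2\<close>, and every element is a
  square, so all nonzero values are taken equally often.\<close>
lemma card_denniston_form_fibre:
  fixes d h :: 'a
  assumes d: "d \<notin> artin_schreier" and h: "h \<noteq> 0"
  shows "card {p. denniston_form d p = h} = CARD('a) + 1"
proof -
  let ?F = "\<lambda>h. {p. denniston_form d p = h}"
  let ?U = "UNIV - {0 :: 'a}"
  have le: "card (?F g) \<le> card (?F k)" if gk: "g \<noteq> 0" "k \<noteq> 0" for g k
  proof -
    obtain c where c: "k / g = c\<^sup>2" using char_two_bij_power2 by (metis bij_pointE)
    then have "c \<noteq> 0" using gk by auto
    have "(\<lambda>(x, y). (c * x, c * y)) ` ?F g \<subseteq> ?F k"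
      using c gk by (auto simp: denniston_form_scale simp flip: c)
    moreover have "inj_on (\<lambda>(x, y). (c * x, c * y)) (?F g)"
      using \<open>c \<noteq> 0\<close> by (auto simp: inj_on_def)
    ultimately show ?thesis by (metis card_inj_on_le finite)
  qed
  have const: "card (?F g) = card (?F h)" if "g \<in> ?U" for g
    using that le[of g h] le[of h g] h by simp
  \<comment> \<open>This makes the factor \<open>CARD('a) - 1\<close> nonzero, so that it cancels at
    the end.\<close>
  have q: "CARD('a) \<ge> 2"
    using card_mono[of UNIV "{0, 1 :: 'a}"] by simp
  have "card (UNIV - {(0 :: 'a, 0 :: 'a)})
      = (\<Sum>g\<in>?U. card {p \<in> UNIV - {(0, 0)}. denniston_form d p = g})"
    by (rule card_eq_sum_card_fibres) (use denniston_form_eq_0_iff[OF d] in auto)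
  also have "\<dots> = (\<Sum>g\<in>?U. card (?F g))"
    by (intro sum.cong arg_cong[where f = card]) (auto simp: denniston_form_def)
  also have "\<dots> = (CARD('a) - 1) * card (?F h)"
    using const by (simp add: card_Diff_subset)
  also have "card (UNIV - {(0 :: 'a, 0 :: 'a)}) = CARD('a) * CARD('a) - 1"
    by (simp add: card_Diff_subset card_cartesian_product flip: UNIV_Times_UNIV)
  also have "\<dots> = (CARD('a) - 1) * (CARD('a) + 1)"
    by (cases "CARD('a)") simp_all
  finally show ?thesis using q by (simp only: mult_cancel1) simp
qed

lemma card_denniston_form_vimage:
  fixes d :: 'a
  assumes d: "d \<notin> artin_schreier" and "0 \<in> H"
  shows "card {p. denniston_form d p \<in> H} = 1 + (CARD('a) + 1) * (card H - 1)"
proof -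
  let ?F = "\<lambda>h. {p. denniston_form d p = h}"
  have "card {p. denniston_form d p \<in> H}
      = (\<Sum>h\<in>H. card {p \<in> {p. denniston_form d p \<in> H}. denniston_form d p = h})"
    by (rule card_eq_sum_card_fibres) auto
  also have "\<dots> = (\<Sum>h\<in>H. card (?F h))"
    by (intro sum.cong arg_cong[where f = card]) auto
  also have "\<dots> = card (?F 0) + (\<Sum>h\<in>H - {0}. card (?F h))"
    using \<open>0 \<in> H\<close> by (simp add: sum.remove)
  also have "?F 0 = {(0, 0)}" using denniston_form_eq_0_iff[OF d] by auto
  also have "(\<Sum>h\<in>H - {0}. card (?F h)) = (\<Sum>h\<in>H - {0}. CARD('a) + 1)"
    using card_denniston_form_fibre[OF d] by (intro sum.cong) auto
  finally show ?thesis using \<open>0 \<in> H\<close> by simp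
qed

text \<open>The form is the norm of \<open>x + y \<omega>\<close> with \<open>\<omega>\<^sup>2 + \<omega> = d\<close>. The product of
  \<open>x + y \<omega>\<close> with the conjugate \<open>b + a (\<omega> + 1)\<close> of \<open>b + a \<omega>\<close> has \<open>\<omega>\<close>-coordinate
  \<open>a x + b y\<close>.\<close>
lemma denniston_form_mult:
  fixes a b d x y :: 'a
  assumes "a * x + b * y = 1"
  shows "denniston_form d (b, a) * denniston_form d (x, y)
       = (x * (a + b) + d * y * a)\<^sup>2 + (x * (a + b) + d * y * a) + d"
proof -
  have "denniston_form d (b, a) * denniston_form d (x, y)
       = (x * (a + b) + d * y * a)\<^sup>2 + (x * (a + b) + d * y * a) * (a * x + b * y)
         + d * (a * x + b * y)\<^sup>2"
  \<comment> \<open>The two sides differ by an explicit multiple of 2, so the identity itself is a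
    plain ring identity.\<close>
  proof -
    have "(x * (a + b) + d * y * a)\<^sup>2 + (x * (a + b) + d * y * a) * (a * x + b * y)
         + d * (a * x + b * y)\<^sup>2 = denniston_form d (b, a) * denniston_form d (x, y)
         + 2 * (a\<^sup>2 * x\<^sup>2 + a * b * x\<^sup>2 + d * a\<^sup>2 * x * y + 2 * d * a * b * x * y)"
      unfolding denniston_form_def fst_conv snd_conv by algebra
    then show ?thesis by (simp only: two_eq_zero mult_zero_left add_0_right)
  qed
  then show ?thesis by (simp add: assms)
qed

lemma denniston_form_not_incident:
  fixes a b d x y :: 'a
  assumes "d \<notin> artin_schreier"
    and "denniston_form d (b, a) * denniston_form d (x, y) \<in> artin_schreier"
  shows "a * x + b * y \<noteq> 1"
proof
  assume eq: "a * x + b * y = 1"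
  define X where "X = x * (a + b) + d * y * a"
  \<comment> \<open>In characteristic two this sum collapses to \<open>d\<close>.\<close>
  have "(X\<^sup>2 + X + d) + (X\<^sup>2 + X) \<in> artin_schreier"
  proof (rule artin_schreier_add)
    show "X\<^sup>2 + X + d \<in> artin_schreier"
      using assms(2) unfolding denniston_form_mult[OF eq] X_def .
    show "X\<^sup>2 + X \<in> artin_schreier" by (simp add: artin_schreier_def)
  qed
  moreover have "(X\<^sup>2 + X + d) + (X\<^sup>2 + X) = ((X\<^sup>2 + X) + (X\<^sup>2 + X)) + d"
    by (simp only: ac_simps)
  ultimately show False using assms(1) by (simp add: char_two_add_self)
qed

end

section \<open>Coordinates for points and lines of the plane\<close>

definition affine_point :: "'a::field \<times> 'a \<Rightarrow> ('a ^ 3) set" where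
  "affine_point p = vec.span {vector [fst p, snd p, 1]}"

text \<open>The coordinates of \<open>l\<close> are swapped in the equation so that the same set of pairs serves for
  the points and for the lines.\<close>
definition affine_line :: "'a::field \<times> 'a \<Rightarrow> ('a ^ 3) set" where
  "affine_line l = {w. snd l * w $ 1 + fst l * w $ 2 + w $ 3 = 0}"

lemma affine_point_in_pg2_points: "affine_point p \<in> pg2_points"
proof -
  have "vector [fst p, snd p, 1] \<noteq> (0 :: 'a ^ 3)"
    by (metis vector_3(3) zero_index zero_neq_one)
  then have "vec.independent {vector [fst p, snd p, 1] :: 'a ^ 3}"
    by simp
  then show ?thesis
    unfolding pg2_points_def affine_point_def
    by (simp add: vec.dim_span_eq_card_independent del: vec.dim_span)
qed

lemma affine_line_in_pg2_lines: "affine_line l \<in> pg2_lines"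
proof -
  obtain b a where l: "l = (b, a)" by (cases l)
  \<comment> \<open>A basis of the line: the first two coordinates are free and the equation
    determines the third.\<close>
  let ?u = "vector [1, 0, - a] :: 'a ^ 3" and ?v = "vector [0, 1, - b] :: 'a ^ 3"
  have sub: "vec.subspace (affine_line l)"
  proof (rule vec.subspaceI)
    fix w z c
    assume "w \<in> affine_line l"
    then have w: "a * w $ 1 + b * w $ 2 + w $ 3 = 0" by (simp add: affine_line_def l)
    have "a * (c *s w) $ 1 + b * (c *s w) $ 2 + (c *s w) $ 3
        = c * (a * w $ 1 + b * w $ 2 + w $ 3)"
      by (simp add: algebra_simps)
    then show "c *s w \<in> affine_line l" using w by (simp add: affine_line_def l)
    assume "z \<in> affine_line l"
    then have z: "a * z $ 1 + b * z $ 2 + z $ 3 = 0" by (simp add: affine_line_def l)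
    have "a * (w + z) $ 1 + b * (w + z) $ 2 + (w + z) $ 3
        = (a * w $ 1 + b * w $ 2 + w $ 3) + (a * z $ 1 + b * z $ 2 + z $ 3)"
      by (simp add: algebra_simps)
    then show "w + z \<in> affine_line l" using w z by (simp add: affine_line_def l)
  qed (simp add: affine_line_def)
  have "affine_line l \<subseteq> vec.span {?u, ?v}"
  proof
    fix w assume "w \<in> affine_line l"
    then have "w $ 3 = - (a * w $ 1 + b * w $ 2)"
      by (simp add: affine_line_def l add_eq_0_iff)
    then have "w = w $ 1 *s ?u + w $ 2 *s ?v"
      by (simp add: vec_eq_iff forall_3 algebra_simps)
    then show "w \<in> vec.span {?u, ?v}"
      by (metis vec.span_add[OF vec.span_scale vec.span_scale] vec.span_base insertI1 insertI2)
  qed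
  moreover have "{?u, ?v} \<subseteq> affine_line l"
    by (simp add: affine_line_def l)
  ultimately have "vec.span {?u, ?v} = affine_line l"
    using sub by (metis vec.span_minimal subset_antisym)
  moreover have "?u \<noteq> ?v" by (metis vector_3(1) zero_neq_one)
  moreover have "vec.independent {?u, ?v}"
  proof (rule vec.independent_insertI)
    show "?u \<notin> vec.span {?v}"
      by (auto simp: vec.span_singleton vec_eq_iff forall_3)
    have "?v \<noteq> 0" by (metis vector_3(2) zero_index zero_neq_one)
    then show "vec.independent {?v}" by simp
  qed
  ultimately have "vec.dim (affine_line l) = 2"
    by (metis vec.dim_span_eq_card_independent card_2_iff)
  then show ?thesis using sub by (simp add: pg2_lines_def)
qed

lemma inj_affine_point: "inj affine_point"
proof (rule injI)
  fix p p' :: "'a \<times> 'a"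
  assume "affine_point p = affine_point p'"
  then have "vector [fst p, snd p, 1] \<in> vec.span {vector [fst p', snd p', 1] :: 'a ^ 3}"
    unfolding affine_point_def by (metis insertI1 vec.span_base)
  \<comment> \<open>The third coordinate forces the scalar to be 1.\<close>
  then show "p = p'"
    by (auto simp: vec.span_singleton vec_eq_iff forall_3 prod_eq_iff)
qed

lemma inj_affine_line: "inj affine_line"
proof (rule injI)
  fix l l' :: "'a \<times> 'a"
  assume eq: "affine_line l = affine_line l'"
  \<comment> \<open>Substituting these two vectors into the equation of \<open>l'\<close> reads off
    both of its coefficients.\<close>
  have "vector [1, 0, - snd l] \<in> affine_line l" "vector [0, 1, - fst l] \<in> affine_line l"
    by (simp_all add: affine_line_def)
  then show "l = l'"
    unfolding eq by (simp add: affine_line_def prod_eq_iff)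
qed

lemma pg2_incident_affine:
  assumes "pg2_incident (affine_point p) (affine_line l)"
  shows "snd l * fst p + fst l * snd p = - 1"
proof -
  have "vector [fst p, snd p, 1] \<in> affine_line l"
    using assms unfolding pg2_incident_def affine_point_def
    by (metis insertI1 subsetD vec.span_base)
  then show ?thesis by (simp add: affine_line_def eq_neg_iff_add_eq_0)
qed

theorem theorem5:
  fixes q v s :: nat
  assumes "even v" and "v > 0" and "q = 2 ^ v"
    and "CARD('a::{field, finite}) = q"
    and "real s = 1 + (real q + 1) * (sqrt (real q) - 1)"
  shows "\<exists>(Y :: ('a ^ 3) set set) (M :: ('a ^ 3) set set).
           Y \<subseteq> pg2_points \<and> M \<subseteq> pg2_lines \<and> card Y = s \<and> card M = s \<and>
           (\<forall>P\<in>Y. \<forall>L\<in>M. \<not> pg2_incident P L)"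
proof -
  obtain m where v: "v = 2 * m" using \<open>even v\<close> by (elim evenE)
  define r :: nat where "r = 2 ^ m"
  have m: "m > 0" and q: "q = r * r"
    using assms v by (simp_all add: r_def mult_2 power_add)
  have card: "CARD('a) = 2 ^ m * 2 ^ m" using assms(4) q by (simp add: r_def)
  have two: "(2 :: 'a) = 0"
    using assms(3,4) by (intro finite_field_char_two) simp
  define K :: "'a set" where "K = frobenius_fixed m"
  have card_K: "card K = r" and K_sub: "K \<subseteq> artin_schreier"
    using subfield_of_square_order[OF two card m] by (simp_all add: K_def r_def)
  have K_mult: "x * y \<in> K" if "x \<in> K" "y \<in> K" for x y
    using that by (simp add: K_def frobenius_fixed_def power_mult_distrib)
  have "0 \<in> K" by (simp add: K_def frobenius_fixed_def)
  obtain d :: 'a where d: "d \<notin> artin_schreier"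
    using artin_schreier_proper[OF two] by auto
  define D where "D = {p. denniston_form d p \<in> K}"
  \<comment> \<open>The subtraction on naturals does not truncate, since \<open>r\<close> is a power
    of 2.\<close>
  have real_r: "real (r - 1) = real r - 1" by (simp add: r_def)
  have "sqrt (real q) = real r" by (simp add: q)
  then have "real s = 1 + (real q + 1) * real (r - 1)"
    using assms(5) real_r by simp
  then have "real s = real (1 + (q + 1) * (r - 1))"
    by (simp only: of_nat_add of_nat_mult of_nat_1)
  then have "s = 1 + (q + 1) * (r - 1)" by (simp only: of_nat_eq_iff)
  then have card_D: "card D = s"
    using card_denniston_form_vimage[OF two d \<open>0 \<in> K\<close>] card_K assms(4) by (simp add: D_def)
  \<comment> \<open>This turns the incidence equation into the normalisation used for the norm
    product.\<close>
  have minus_one: "- 1 = (1 :: 'a)"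
    using two by (intro minus_unique) simp
  have not_incident: "\<not> pg2_incident (affine_point p) (affine_line l)"
    if "p \<in> D" "l \<in> D" for p l
  proof
    assume "pg2_incident (affine_point p) (affine_line l)"
    then have "snd l * fst p + fst l * snd p = 1"
      using pg2_incident_affine[of p l] minus_one by simp
    moreover have "denniston_form d l * denniston_form d p \<in> artin_schreier"
      using that K_mult K_sub by (auto simp: D_def)
    ultimately show False
      using denniston_form_not_incident[OF two d, of "fst l" "snd l" "fst p" "snd p"] by simp
  qed
  show ?thesis
  proof (rule exI[of _ "affine_point ` D"], rule exI[of _ "affine_line ` D"], intro conjI)
    show "card (affine_point ` D) = s" "card (affine_line ` D) = s"
      using card_D by (simp_all add: card_image inj_on_subset[OF inj_affine_point]
          inj_on_subset[OF inj_affine_line])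
  qed (use affine_point_in_pg2_points affine_line_in_pg2_lines not_incident in auto)
qed

end
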